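(* There is no uniform bound on stretch factors of Delaunay triangulations in the hyperbolic plane $\mathbb{H}^2$: for every $C>0$ there exist a finite point set $V\subset\mathbb{H}^2$ and a Delaunay triangulation $T$ of $V$ in $\mathbb{H}^2$ whose stretch factor satisfies $s(T)>C$.
   Context: $\mathbb{H}^2$ is the hyperbolic plane of curvature $-1$ with distance $d_{\mathbb{H}^2}$. For a finite set $V\subset\mathbb{H}^2$, a Delaunay triangulation of $V$ is a triangulation $T$ of the (hyperbolic) convex hull of $V$ with vertex set $V$ and geodesic edges satisfying the empty disk property: the interior of the circumdisk of every triangle of $T$ contains no point of $V$. (Points of $V$ are allowed on the boundary circles of the circumdisks, so if more than three points of $V$ lie on a common circle a Delaunay triangulation need not be unique.) The $1$-skeleton of $T$ is regarded as a metric graph $(T,d)$: each edge is weighted by its hyperbolic length, and $d(p,q)$ is the length of a shortest path in the graph joining the vertices $p$ and $q$. The stretch factor of $T$ is $$s(T)=\max_{p,q\in V,\ p\neq q}\frac{d(p,q)}{d_{\mathbb{H}^2}(p,q)}.$$ *)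

theory Defs
  imports "HOL-Analysis.Analysis" "Graph_Theory.Shortest_Path"
begin

text \<open>
  The hyperbolic plane of curvature \<open>-1\<close> is the open unit disk with the Beltrami--Klein distance.
  The notions below refer to it only through its set of points and its distance function.
\<close>

definition hyp_plane :: "complex set" where
  "hyp_plane = ball 0 1"

definition hdist :: "complex \<Rightarrow> complex \<Rightarrow> real" where
  "hdist x y = arcosh ((1 - x \<bullet> y) / (sqrt (1 - (norm x)\<^sup>2) * sqrt (1 - (norm y)\<^sup>2)))"

definition geodesic_seg :: "complex \<Rightarrow> complex \<Rightarrow> complex set" where
  "geodesic_seg x y = {z \<in> hyp_plane. hdist x z + hdist z y = hdist x y}"

definition hyp_convex :: "complex set \<Rightarrow> bool" where
  "hyp_convex S \<longleftrightarrow> S \<subseteq> hyp_plane \<and> (\<forall>x\<in>S. \<forall>y\<in>S. geodesic_seg x y \<subseteq> S)"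

definition hyp_hull :: "complex set \<Rightarrow> complex set" where
  "hyp_hull V = hyp_convex hull V"

definition open_hdisk :: "complex \<Rightarrow> real \<Rightarrow> complex set" where
  "open_hdisk c r = {z \<in> hyp_plane. hdist c z < r}"

text \<open>
  A triangulation is represented by the set of the vertex sets of its triangles. The triangle
  spanned by three points is their hyperbolic convex hull, and its edges are the geodesic
  segments between them; three points spanning a triangle must not lie on a common geodesic.
\<close>

definition hyp_collinear :: "complex set \<Rightarrow> bool" where
  "hyp_collinear t \<longleftrightarrow> (\<exists>x\<in>t. \<exists>y\<in>t. t \<subseteq> geodesic_seg x y)"

definition triangulation_of_hull :: "complex set \<Rightarrow> complex set set \<Rightarrow> bool" where
  "triangulation_of_hull V T \<longleftrightarrow>
     (\<forall>t\<in>T. card t = 3 \<and> \<not> hyp_collinear t) \<and>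
     \<Union>T = V \<and>
     (\<Union>t\<in>T. hyp_hull t) = hyp_hull V \<and>
     (\<forall>t\<in>T. \<forall>t'\<in>T. hyp_hull t \<inter> hyp_hull t' = hyp_hull (t \<inter> t'))"

text \<open>
  A hyperbolic triangle need not have a circumscribed circle: its vertices may instead lie on a
  horocycle or on an equidistant curve. Here every triangle is required to have a genuine
  circumcentre \<open>c\<close> in the hyperbolic plane, and thus a compact circumdisk.
\<close>

definition is_circumdisk :: "complex \<Rightarrow> real \<Rightarrow> complex set \<Rightarrow> bool" where
  "is_circumdisk c r t \<longleftrightarrow> c \<in> hyp_plane \<and> (\<forall>v\<in>t. hdist c v = r)"

definition delaunay_triangulation :: "complex set \<Rightarrow> complex set set \<Rightarrow> bool" where
  "delaunay_triangulation V T \<longleftrightarrow>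
     triangulation_of_hull V T \<and>
     (\<forall>t\<in>T. \<exists>c r. is_circumdisk c r t \<and> open_hdisk c r \<inter> V = {})"

text \<open>
  The 1-skeleton has both orientations of every edge as arcs. Its shortest path distance is
  extended-real valued, with infinite value for pairs that are not joined by a path;
  \<open>real_of_ereal\<close> would turn that value into \<open>0\<close>, so a disconnected graph could not
  produce a large stretch factor.
\<close>

definition skeleton :: "complex set \<Rightarrow> complex set set \<Rightarrow> (complex, complex \<times> complex) pre_digraph" where
  "skeleton V T =
     \<lparr> verts = V, arcs = {(p, q). p \<noteq> q \<and> (\<exists>t\<in>T. p \<in> t \<and> q \<in> t)}, tail = fst, head = snd \<rparr>"

definition graph_dist :: "complex set \<Rightarrow> complex set set \<Rightarrow> complex \<Rightarrow> complex \<Rightarrow> real" where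
  "graph_dist V T p q = real_of_ereal (wf_digraph.\<mu> (skeleton V T) (\<lambda>(x, y). hdist x y) p q)"

definition stretch_factor :: "complex set \<Rightarrow> complex set set \<Rightarrow> real" where
  "stretch_factor V T = Max {graph_dist V T p q / hdist p q | p q. p \<in> V \<and> q \<in> V \<and> p \<noteq> q}"

text \<open>
  In this model the geodesic segments and convex hulls defined through the distance are the
  Euclidean ones.
\<close>

lemma arcosh_add_eq_iff:
  fixes A B C :: real
  assumes "A \<ge> 1" "B \<ge> 1" "C \<ge> 1"
  shows "arcosh A + arcosh B = arcosh C \<longleftrightarrow> C \<ge> A * B \<and> (C - A * B)\<^sup>2 = (A\<^sup>2 - 1) * (B\<^sup>2 - 1)"
proof -
  have nn: "(A\<^sup>2 - 1) * (B\<^sup>2 - 1) \<ge> 0"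
    using assms by (intro mult_nonneg_nonneg) (auto simp: one_le_power)
  have "arcosh A + arcosh B = arcosh C \<longleftrightarrow> cosh (arcosh A + arcosh B) = C"
    using assms arcosh_cosh_real[of "arcosh A + arcosh B"] by auto
  also have "\<dots> \<longleftrightarrow> C - A * B = sqrt ((A\<^sup>2 - 1) * (B\<^sup>2 - 1))"
    using assms by (auto simp: cosh_add sinh_arcosh_real real_sqrt_mult)
  also have "\<dots> \<longleftrightarrow> C \<ge> A * B \<and> (C - A * B)\<^sup>2 = (A\<^sup>2 - 1) * (B\<^sup>2 - 1)"
    using nn by (metis diff_ge_0_iff_ge real_sqrt_ge_zero real_sqrt_pow2 real_sqrt_unique)
  finally show ?thesis .
qed

lemma klein_cosh_ge_1:
  fixes x y :: complex
  assumes "norm x < 1" "norm y < 1"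
  shows "(1 - x \<bullet> y) / (sqrt (1 - (norm x)\<^sup>2) * sqrt (1 - (norm y)\<^sup>2)) \<ge> 1"
proof -
  have pos: "1 - (norm x)\<^sup>2 > 0" "1 - (norm y)\<^sup>2 > 0"
    using assms by (auto simp: power_less_one_iff abs_square_less_1)
  have "norm x * norm y \<le> 1" using assms by (intro mult_le_one) auto
  have "(1 - (norm x)\<^sup>2) * (1 - (norm y)\<^sup>2) \<le> (1 - norm x * norm y)\<^sup>2"
    using zero_le_power2[of "norm x - norm y"] by (simp add: power2_eq_square algebra_simps)
  then have "sqrt ((1 - (norm x)\<^sup>2) * (1 - (norm y)\<^sup>2)) \<le> 1 - norm x * norm y"
    using \<open>norm x * norm y \<le> 1\<close> by (intro real_le_lsqrt) auto
  also have "\<dots> \<le> 1 - x \<bullet> y"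
    using norm_cauchy_schwarz[of x y] by simp
  finally show ?thesis using pos by (simp add: real_sqrt_mult)
qed

lemma geodesic_seg_eq_closed_segment:
  assumes x: "x \<in> hyp_plane" and y: "y \<in> hyp_plane"
  shows "geodesic_seg x y = closed_segment x y"
proof -
  have key: "hdist x z + hdist z y = hdist x y \<longleftrightarrow> z \<in> closed_segment x y"
    if z: "z \<in> hyp_plane" for z
  proof -
    define e where "e = 1 - (norm z)\<^sup>2"
    define f where "f = 1 - (norm x)\<^sup>2"
    define g where "g = 1 - (norm y)\<^sup>2"
    have pos: "e > 0" "f > 0" "g > 0"
      using x y z by (auto simp: e_def f_def g_def hyp_plane_def power_less_one_iff abs_square_less_1)
    define u where "u = x - z"
    define v where "v = y - z"
    define Q where "Q = (\<lambda>a b. e * (a \<bullet> b) + (a \<bullet> z) * (b \<bullet> z))"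
    define cr where "cr = Re u * Im v - Im u * Re v"
    define A where "A = (1 - x \<bullet> z) / (sqrt f * sqrt e)"
    define B where "B = (1 - z \<bullet> y) / (sqrt e * sqrt g)"
    define C where "C = (1 - x \<bullet> y) / (sqrt f * sqrt g)"
    have ge1: "A \<ge> 1" "B \<ge> 1" "C \<ge> 1"
      using klein_cosh_ge_1[of x z] klein_cosh_ge_1[of z y] klein_cosh_ge_1[of x y] x y z
      by (auto simp: A_def B_def C_def e_def f_def g_def hyp_plane_def)
    have nz: "e = 1 - ((Re z)\<^sup>2 + (Im z)\<^sup>2)" "f = 1 - ((Re x)\<^sup>2 + (Im x)\<^sup>2)"
       "g = 1 - ((Re y)\<^sup>2 + (Im y)\<^sup>2)"
      by (simp_all add: e_def f_def g_def cmod_power2)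
    have CAB: "C - A * B = - Q u v / (e * sqrt f * sqrt g)"
    proof -
      have ss: "sqrt e * sqrt e = e" using pos by simp
      have "C - A * B = ((1 - x \<bullet> y) * e - (1 - x \<bullet> z) * (1 - z \<bullet> y)) / (e * sqrt f * sqrt g)"
      proof -
        have "A * B = (1 - x \<bullet> z) * (1 - z \<bullet> y) / ((sqrt e * sqrt e) * sqrt f * sqrt g)"
          unfolding A_def B_def by (simp add: mult_ac)
        moreover have "C = (1 - x \<bullet> y) * e / (e * sqrt f * sqrt g)"
          using pos unfolding C_def by simp
        ultimately show ?thesis unfolding ss by (simp add: diff_divide_distrib)
      qed
      also have "(1 - x \<bullet> y) * e - (1 - x \<bullet> z) * (1 - z \<bullet> y) = - Q u v"
        unfolding Q_def u_def v_def nz inner_complex_def by (simp add: power2_eq_square algebra_simps)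
      finally show ?thesis .
    qed
    have A2: "A\<^sup>2 - 1 = Q u u / (e * f)"
    proof -
      have "A\<^sup>2 - 1 = ((1 - x \<bullet> z)\<^sup>2 - e * f) / (e * f)"
        using pos unfolding A_def by (simp add: field_simps power_mult_distrib power_divide)
      also have "(1 - x \<bullet> z)\<^sup>2 - e * f = Q u u"
        unfolding Q_def u_def nz inner_complex_def by (simp add: power2_eq_square algebra_simps)
      finally show ?thesis .
    qed
    have B2: "B\<^sup>2 - 1 = Q v v / (e * g)"
    proof -
      have "B\<^sup>2 - 1 = ((1 - z \<bullet> y)\<^sup>2 - e * g) / (e * g)"
        using pos unfolding B_def by (simp add: field_simps power_mult_distrib power_divide)
      also have "(1 - z \<bullet> y)\<^sup>2 - e * g = Q v v"
        unfolding Q_def v_def nz inner_complex_def by (simp add: power2_eq_square algebra_simps)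
      finally show ?thesis .
    qed
    have gram: "Q u u * Q v v - (Q u v)\<^sup>2 = e * cr\<^sup>2"
      unfolding Q_def nz cr_def inner_complex_def by (simp add: power2_eq_square algebra_simps)
    have Qpos: "Q w w > 0" if "w \<noteq> 0" for w
      using that pos unfolding Q_def by (intro add_pos_nonneg mult_pos_pos) auto
    have "hdist x z + hdist z y = hdist x y \<longleftrightarrow> arcosh A + arcosh B = arcosh C"
      by (simp add: hdist_def A_def B_def C_def e_def f_def g_def)
    also have "\<dots> \<longleftrightarrow> C - A * B \<ge> 0 \<and> (C - A * B)\<^sup>2 = (A\<^sup>2 - 1) * (B\<^sup>2 - 1)"
      using arcosh_add_eq_iff[OF ge1] by auto
    also have "C - A * B \<ge> 0 \<longleftrightarrow> Q u v \<le> 0"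
    proof -
      have "e * sqrt f * sqrt g > 0" using pos by simp
      then show ?thesis unfolding CAB by (simp add: divide_le_0_iff not_le[symmetric])
    qed
    also have "(C - A * B)\<^sup>2 = (A\<^sup>2 - 1) * (B\<^sup>2 - 1) \<longleftrightarrow> (Q u v)\<^sup>2 = Q u u * Q v v"
    proof -
      have "(C - A * B)\<^sup>2 = (Q u v)\<^sup>2 / (e\<^sup>2 * f * g)"
        using pos unfolding CAB by (simp add: power_mult_distrib power_divide)
      moreover have "(A\<^sup>2 - 1) * (B\<^sup>2 - 1) = Q u u * Q v v / (e\<^sup>2 * f * g)"
        unfolding A2 B2 by (simp add: power2_eq_square mult_ac)
      ultimately show ?thesis using pos by simp
    qed
    also have "\<dots> \<longleftrightarrow> cr = 0" using gram pos by auto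
    also have "Q u v \<le> 0 \<and> cr = 0 \<longleftrightarrow> z \<in> closed_segment x y"
    proof
      assume "z \<in> closed_segment x y"
      then obtain s where s: "0 \<le> s" "s \<le> 1" "z = (1 - s) *\<^sub>R x + s *\<^sub>R y"
        by (auto simp: closed_segment_def)
      have uv: "u = s *\<^sub>R (x - y)" "v = (s - 1) *\<^sub>R (x - y)"
        unfolding u_def v_def s(3) by (simp_all add: algebra_simps)
      have "Q u v = (s * (s - 1)) * Q (x - y) (x - y)"
        unfolding Q_def uv by (simp add: algebra_simps)
      moreover have "Q (x - y) (x - y) \<ge> 0"
        using pos unfolding Q_def by (intro add_nonneg_nonneg) auto
      moreover have "s * (s - 1) \<le> 0" using s by (simp add: mult_le_0_iff)
      ultimately have "Q u v \<le> 0" by (simp add: mult_le_0_iff)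
      moreover have "cr = 0" unfolding cr_def uv by simp
      ultimately show "Q u v \<le> 0 \<and> cr = 0" by simp
    next
      assume h: "Q u v \<le> 0 \<and> cr = 0"
      show "z \<in> closed_segment x y"
      proof (cases "u = 0")
        case True
        then show ?thesis by (simp add: u_def)
      next
        case False
        have "(norm u)\<^sup>2 *\<^sub>R v = (u \<bullet> v) *\<^sub>R u"
        proof -
          have c: "Re u * Im v = Im u * Re v" using h by (simp add: cr_def)
          have "((Re u)\<^sup>2 + (Im u)\<^sup>2) * Re v = (Re u * Re v + Im u * Im v) * Re u"
            "((Re u)\<^sup>2 + (Im u)\<^sup>2) * Im v = (Re u * Re v + Im u * Im v) * Im u"
            using c by algebra+
          then show ?thesis
            unfolding complex_eq_iff inner_complex_def cmod_power2 by simp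
        qed
        moreover define k where "k = (u \<bullet> v) / (norm u)\<^sup>2"
        ultimately have vk: "v = k *\<^sub>R u"
          using False by (simp add: k_def eq_vector_fraction_iff)
        have "Q u v = k * Q u u" unfolding Q_def vk by (simp add: algebra_simps)
        then have k: "k \<le> 0" using h Qpos[OF False] by (simp add: mult_le_0_iff)
        define s where "s = 1 / (1 - k)"
        have s: "0 \<le> s" "s \<le> 1" using k by (auto simp: s_def)
        have "(1 - s) *\<^sub>R u + s *\<^sub>R v = ((1 - s) + s * k) *\<^sub>R u"
          unfolding vk by (simp add: algebra_simps)
        also have "(1 - s) + s * k = 0" using k by (simp add: s_def field_simps)
        finally have "z = (1 - s) *\<^sub>R x + s *\<^sub>R y"
          unfolding u_def v_def by (simp add: algebra_simps)
        then show ?thesis using s by (auto simp: closed_segment_def)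
      qed
    qed
    finally show ?thesis .
  qed
  have "closed_segment x y \<subseteq> hyp_plane"
    using x y by (simp add: hyp_plane_def closed_segment_subset)
  then show ?thesis using key by (auto simp: geodesic_seg_def)
qed

lemma hyp_hull_eq_convex_hull:
  assumes V: "V \<subseteq> hyp_plane"
  shows "hyp_hull V = convex hull V"
proof -
  have 1: "hyp_convex S \<longleftrightarrow> S \<subseteq> hyp_plane \<and> convex S" for S
    unfolding hyp_convex_def convex_contains_segment
    by (metis geodesic_seg_eq_closed_segment subset_iff)
  have "convex hyp_plane" by (simp add: hyp_plane_def)
  then have 2: "hyp_convex (S \<inter> hyp_plane)" if "convex S" for S
    using that by (simp add: 1 convex_Int)
  show ?thesis unfolding hyp_hull_def
  proof
    show "hyp_convex hull V \<subseteq> convex hull V"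
      using 2[OF convex_convex_hull[of V]] V hull_subset[of V convex]
      by (metis Int_lower1 hull_minimal le_inf_iff subset_trans)
    show "convex hull V \<subseteq> hyp_convex hull V"
      unfolding hull_def using 1 by blast
  qed
qed

end

theory Submission
  imports Defs "HOL-Real_Asymp.Real_Asymp"
begin

text \<open>
  Points on a common circle are in empty-disk position for every triangulation of their hull, so
  one may triangulate badly. Place \<open>m + 1\<close> points on a circle about the origin, alternately above
  and below the real axis and with equally spaced real parts, and join each point to the next two.
  An edge advances by at most two indices and the circle can be chosen so large that every edge is
  longer than a constant, so the graph distance between the extreme points is of order \<open>m\<close>. Their
  hyperbolic distance is only of order \<open>ln m\<close>, because circles are exponentially long compared to
  their diameter.
\<close>

section \<open>Chords of a circle\<close>

text \<open>Power of a point for the line through \<open>p\<close> and \<open>q\<close>: the sign of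
  \<open>u * (1 - u)\<close> decides whether the point lies inside or outside the circle.\<close>

lemma norm_affine_combination:
  fixes p q :: "'a::real_inner"
  assumes "norm p = \<rho>" "norm q = \<rho>"
  shows "(norm ((1 - u) *\<^sub>R p + u *\<^sub>R q))\<^sup>2 = \<rho>\<^sup>2 - u * (1 - u) * (norm (p - q))\<^sup>2"
proof -
  have "p \<bullet> p = \<rho>\<^sup>2" "q \<bullet> q = \<rho>\<^sup>2"
    using assms by (auto simp flip: power2_norm_eq_inner)
  then show ?thesis
    unfolding power2_norm_eq_inner
    by (simp add: inner_add_left inner_add_right inner_diff_left inner_diff_right inner_commute[of q p]
        algebra_simps power2_eq_square)
qed

text \<open>Strict convexity of the disk: by the power formula a point of the chord has norm
  \<open>\<rho>\<close> only if \<open>u * (1 - u) = 0\<close>, unless the chord is a single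
  point.\<close>

lemma circle_closed_segment_endpoint:
  fixes p q :: "'a::real_inner"
  assumes "norm p = \<rho>" "norm q = \<rho>" "norm z = \<rho>" "z \<in> closed_segment p q"
  shows "z = p \<or> z = q"
proof -
  obtain u where u: "z = (1 - u) *\<^sub>R p + u *\<^sub>R q"
    using assms(4) by (auto simp: closed_segment_def)
  have "u * (1 - u) * (norm (p - q))\<^sup>2 = 0"
    using norm_affine_combination[OF assms(1,2), of u] assms(3) u by simp
  then consider "u = 0" | "u = 1" | "p = q" by auto
  then show ?thesis by cases (auto simp: u simp flip: scaleR_add_left)
qed

text \<open>The inner product with \<open>\<i> * (q - p)\<close> is the cross product of
  \<open>q - p\<close> and \<open>z - p\<close>, whose sign gives the side of the line. Comparing
  \<open>z\<close> with the point of the line that has the same real part reduces it to a difference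
  of heights.\<close>

lemma line_point_eq:
  fixes p q z :: complex
  assumes "Re p \<noteq> Re q"
  defines "u \<equiv> (Re z - Re p) / (Re q - Re p)"
  shows "(\<i> * (q - p)) \<bullet> (z - p) = (Re q - Re p) * (Im z - Im ((1 - u) *\<^sub>R p + u *\<^sub>R q))"
    and "Re ((1 - u) *\<^sub>R p + u *\<^sub>R q) = Re z"
proof -
  have u: "u * (Re q - Re p) = Re z - Re p" using assms(1) by (simp add: u_def)
  then show "Re ((1 - u) *\<^sub>R p + u *\<^sub>R q) = Re z" by (simp add: algebra_simps)
  show "(\<i> * (q - p)) \<bullet> (z - p) = (Re q - Re p) * (Im z - Im ((1 - u) *\<^sub>R p + u *\<^sub>R q))"
    using u by (simp add: inner_complex_def) algebra
qed

lemma chord_eq_line_Int_disk: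
  fixes p q z :: complex
  assumes "norm p = \<rho>" "norm q = \<rho>" "Re p < Re q"
    and "(\<i> * (q - p)) \<bullet> (z - p) = 0" "norm z \<le> \<rho>"
  shows "z \<in> closed_segment p q"
proof -
  define u where "u = (Re z - Re p) / (Re q - Re p)"
  have z: "z = (1 - u) *\<^sub>R p + u *\<^sub>R q"
    using line_point_eq[of p q z] assms(3,4) by (auto simp: complex_eq_iff u_def)
  have "(norm z)\<^sup>2 \<le> \<rho>\<^sup>2" using assms(5) by (simp add: power_mono)
  then have "0 \<le> u * (1 - u) * (norm (p - q))\<^sup>2"
    using norm_affine_combination[OF assms(1,2), of u] z by simp
  moreover have "(norm (p - q))\<^sup>2 > 0" using assms(3) by auto
  ultimately have "0 \<le> u * (1 - u)" by (simp add: zero_le_mult_iff)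
  then have "0 \<le> u" "u \<le> 1" by (auto simp: zero_le_mult_iff)
  then show ?thesis using z by (auto simp: closed_segment_def)
qed

text \<open>
  Outside the chord, the line through \<open>p\<close> and \<open>q\<close> lies outside the disk, so its point with the
  same real part as \<open>z\<close> has a larger absolute imaginary part than \<open>z\<close>.
\<close>

lemma chord_sides:
  fixes p q z :: complex
  assumes "norm p = \<rho>" "norm q = \<rho>" "norm z = \<rho>" "Re p < Re q"
    and s: "\<bar>s\<bar> = 1" "s * Im p > 0" "s * Im q < 0"
  shows "Re z < Re p \<Longrightarrow> s * ((\<i> * (q - p)) \<bullet> (z - p)) < 0"
    and "Re q < Re z \<Longrightarrow> s * ((\<i> * (q - p)) \<bullet> (z - p)) > 0"
proof -
  define u where "u = (Re z - Re p) / (Re q - Re p)"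
  define P where "P = (1 - u) *\<^sub>R p + u *\<^sub>R q"
  note line = line_point_eq[of p q z, folded u_def, folded P_def]
  have sP: "s * Im P = (1 - u) * (s * Im p) + u * (s * Im q)"
    by (simp add: P_def algebra_simps)
  have outside: "\<bar>Im z\<bar> < \<bar>Im P\<bar>" if "u * (1 - u) < 0"
  proof -
    have "(norm (p - q))\<^sup>2 > 0" using assms(4) by auto
    then have "u * (1 - u) * (norm (p - q))\<^sup>2 < 0"
      using that by (rule mult_neg_pos[rotated])
    then have "(norm P)\<^sup>2 > (norm z)\<^sup>2"
      using norm_affine_combination[OF assms(1,2), of u] assms(3) by (simp add: P_def)
    then have "(Im z)\<^sup>2 < (Im P)\<^sup>2"
      using line(2) assms(4) by (simp add: cmod_power2)
    then show ?thesis using abs_le_square_iff[of "Im P" "Im z"] by linarith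
  qed
  have s_abs: "s = 1 \<or> s = -1" using s(1) by auto
  have val: "s * ((\<i> * (q - p)) \<bullet> (z - p)) = (Re q - Re p) * (s * Im z - s * Im P)"
    by (subst line(1)) (use assms(4) in \<open>auto simp: algebra_simps\<close>)
  {
    assume "Re z < Re p"
    then have u: "u < 0" using assms(4) by (simp add: u_def divide_less_0_iff)
    then have "u * (1 - u) < 0" by (simp add: mult_less_0_iff)
    \<comment> \<open>Beyond \<open>p\<close> the line stays on the side of the real axis where
      \<open>p\<close> lies: with \<open>u < 0\<close> both terms of \<open>sP\<close> are positive.
      Together with \<open>outside\<close> this fixes the sign of the height difference.\<close>
    moreover have "s * Im P > 0"
      unfolding sP using u s mult_pos_pos[of "1 - u" "s * Im p"] mult_neg_neg[of u "s * Im q"] by linarith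
    ultimately have "s * Im z < s * Im P" using outside s_abs by auto
    then show "s * ((\<i> * (q - p)) \<bullet> (z - p)) < 0"
      unfolding val using assms(4) by (simp add: mult_less_0_iff)
  next
    assume "Re q < Re z"
    then have u: "u > 1" using assms(4) by (simp add: u_def less_divide_eq)
    then have "u * (1 - u) < 0" by (simp add: mult_less_0_iff)
    moreover have "s * Im P < 0"
      unfolding sP using u s mult_neg_pos[of "1 - u" "s * Im p"] mult_pos_neg[of u "s * Im q"] by linarith
    ultimately have "s * Im z > s * Im P" using outside s_abs by auto
    then show "s * ((\<i> * (q - p)) \<bullet> (z - p)) > 0"
      unfolding val using assms(4) by (simp add: zero_less_mult_iff)
  }
qed

text \<open>In a convex combination representing \<open>z\<close>, the weighted excesses
  \<open>a \<bullet> x - b\<close> are nonnegative and sum to at most 0, so all weight sits on the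
  points of the face.\<close>

lemma convex_hull_supporting_hyperplane:
  fixes S :: "'a::real_inner set"
  assumes "finite S" "\<And>x. x \<in> S \<Longrightarrow> b \<le> a \<bullet> x" "z \<in> convex hull S" "a \<bullet> z \<le> b"
  shows "z \<in> convex hull {x \<in> S. a \<bullet> x = b}"
proof -
  obtain u where u: "\<And>x. x \<in> S \<Longrightarrow> 0 \<le> u x" "sum u S = 1" "z = (\<Sum>x\<in>S. u x *\<^sub>R x)"
    using assms(3) by (auto simp: convex_hull_finite[OF assms(1)])
  have "(\<Sum>x\<in>S. u x * (a \<bullet> x - b)) = a \<bullet> z - b"
    using u(2) by (simp add: u(3) inner_sum_right right_diff_distrib sum_subtractf flip: sum_distrib_right)
  moreover have nn: "0 \<le> u x * (a \<bullet> x - b)" if "x \<in> S" for x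
    using that assms(2) u(1) by simp
  ultimately have "(\<Sum>x\<in>S. u x * (a \<bullet> x - b)) = 0"
    using assms(4) sum_nonneg[of S "\<lambda>x. u x * (a \<bullet> x - b)"] by force
  then have zero: "u x = 0" if "x \<in> S" "a \<bullet> x \<noteq> b" for x
    using that sum_nonneg_eq_0_iff[OF assms(1) nn] by auto
  let ?F = "{x \<in> S. a \<bullet> x = b}"
  have "sum u ?F = 1" "(\<Sum>x\<in>?F. u x *\<^sub>R x) = z"
    using sum.mono_neutral_left[OF assms(1), of ?F u]
      sum.mono_neutral_left[OF assms(1), of ?F "\<lambda>x. u x *\<^sub>R x"] zero u(2,3) by auto
  then show ?thesis
    using assms(1) u(1) by (auto simp: convex_hull_finite intro!: exI[of _ u])
qed

section \<open>Zigzag triangulations\<close>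

text \<open>The alternating signs make each chord from \<open>w k\<close> to
  \<open>w (Suc k)\<close> cross the real axis; hence its line has all earlier points on one side
  and all later points on the other.\<close>

locale zigzag =
  fixes w :: "nat \<Rightarrow> complex" and \<rho> :: real and m :: nat
  assumes norm_w: "k \<le> m \<Longrightarrow> norm (w k) = \<rho>"
    and Re_w_less: "i < j \<Longrightarrow> j \<le> m \<Longrightarrow> Re (w i) < Re (w j)"
    and alternating: "k \<le> m \<Longrightarrow> (-1) ^ k * Im (w k) > 0"
    and m_ge_2: "2 \<le> m"
    and \<rho>_less_1: "\<rho> < 1"
begin

definition V :: "complex set" where
  "V = w ` {..m}"

definition triangle :: "nat \<Rightarrow> complex set" where
  "triangle k = {w k, w (Suc k), w (Suc (Suc k))}"

definition T :: "complex set set" where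
  "T = triangle ` {k. Suc (Suc k) \<le> m}"

text \<open>The factor \<open>(-1) ^ k\<close> cancels the alternation, so that
  \<open>normal k\<close> always points towards the points of larger index.\<close>

definition normal :: "nat \<Rightarrow> complex" where
  "normal k = (-1) ^ k *\<^sub>R (\<i> * (w (Suc k) - w k))"

lemma w_eq_iff: "i \<le> m \<Longrightarrow> j \<le> m \<Longrightarrow> w i = w j \<longleftrightarrow> i = j"
  using Re_w_less by (metis less_irrefl nat_neq_iff)

lemma V_subset: "V \<subseteq> hyp_plane"
  using norm_w \<rho>_less_1 by (auto simp: V_def hyp_plane_def)

lemma Union_T: "\<Union>T = V"
proof
  show "\<Union>T \<subseteq> V" by (auto simp: T_def V_def triangle_def)
  show "V \<subseteq> \<Union>T"
  proof
    fix x assume "x \<in> V"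
    then obtain k where k: "k \<le> m" "x = w k" by (auto simp: V_def)
    \<comment> \<open>The last two points start no triangle; they belong to the final triangle, of
      index \<open>m - 2\<close>.\<close>
    consider "Suc (Suc k) \<le> m" | "k = Suc (m - 2)" | "k = Suc (Suc (m - 2))"
      using k m_ge_2 by linarith
    then have "\<exists>j. Suc (Suc j) \<le> m \<and> x \<in> triangle j"
    proof cases
      case 1
      then show ?thesis by (intro exI[of _ k]) (auto simp: triangle_def k)
    next
      case 2
      then show ?thesis using m_ge_2 by (intro exI[of _ "m - 2"]) (auto simp: triangle_def k)
    next
      case 3
      then show ?thesis using m_ge_2 by (intro exI[of _ "m - 2"]) (auto simp: triangle_def k)
    qed
    then show "x \<in> \<Union>T" by (auto simp: T_def)
  qed
qed

lemma hyp_hull_V: "S \<subseteq> V \<Longrightarrow> hyp_hull S = convex hull S"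
  using V_subset by (intro hyp_hull_eq_convex_hull) auto

lemma triangle_subset_V: "Suc (Suc k) \<le> m \<Longrightarrow> triangle k \<subseteq> V"
  by (auto simp: triangle_def V_def)

section \<open>Separation of the points by the lines through consecutive points\<close>

lemma normal_diff: "normal k \<bullet> z - normal k \<bullet> w k = (-1) ^ k * ((\<i> * (w (Suc k) - w k)) \<bullet> (z - w k))"
  by (simp add: normal_def inner_diff_right right_diff_distrib)

lemma
  assumes "Suc k \<le> m" "j \<le> m"
  shows normal_less: "j < k \<Longrightarrow> normal k \<bullet> w j < normal k \<bullet> w k"
    and normal_greater: "Suc k < j \<Longrightarrow> normal k \<bullet> w k < normal k \<bullet> w j"
proof -
  have "norm (w k) = \<rho>" "norm (w (Suc k)) = \<rho>" "norm (w j) = \<rho>" "Re (w k) < Re (w (Suc k))"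
    "\<bar>(-1) ^ k :: real\<bar> = 1" "(-1) ^ k * Im (w k) > 0" "(-1) ^ k * Im (w (Suc k)) < 0"
    using assms norm_w Re_w_less[of k "Suc k"] alternating[of k] alternating[of "Suc k"] by auto
  note sides = chord_sides[OF this]
  show "j < k \<Longrightarrow> normal k \<bullet> w j < normal k \<bullet> w k"
    using sides(1) normal_diff[of k "w j"] Re_w_less[of j k] assms by simp
  show "Suc k < j \<Longrightarrow> normal k \<bullet> w k < normal k \<bullet> w j"
    using sides(2) normal_diff[of k "w j"] Re_w_less[of "Suc k" j] assms by simp
qed

lemma normal_Suc: "normal k \<bullet> w (Suc k) = normal k \<bullet> w k"
  using normal_diff[of k "w (Suc k)"] by (simp add: inner_complex_def algebra_simps)

lemma normal_le: "Suc k \<le> m \<Longrightarrow> j \<le> Suc k \<Longrightarrow> normal k \<bullet> w j \<le> normal k \<bullet> w k"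
  using normal_less[of k j] normal_Suc[of k] by (auto simp: le_Suc_eq less_le)

lemma normal_ge: "j \<le> m \<Longrightarrow> k \<le> j \<Longrightarrow> Suc k \<le> m \<Longrightarrow> normal k \<bullet> w k \<le> normal k \<bullet> w j"
  using normal_greater[of k j] normal_Suc[of k]
  by (metis le_neq_implies_less less_imp_le not_less_eq order_refl Suc_leI)

lemma mem_chord:
  assumes "Suc k \<le> m" "normal k \<bullet> z = normal k \<bullet> w k" "norm z \<le> \<rho>"
  shows "z \<in> closed_segment (w k) (w (Suc k))"
  using assms normal_diff[of k z] norm_w Re_w_less[of k "Suc k"]
  by (intro chord_eq_line_Int_disk[of _ \<rho>]) auto

section \<open>The triangles cover the hull\<close>

lemma norm_hull_V:
  assumes "z \<in> convex hull V"
  shows "norm z \<le> \<rho>"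
proof -
  have "convex hull V \<subseteq> cball 0 \<rho>"
    using norm_w by (intro hull_minimal) (auto simp: V_def)
  then show ?thesis using assms by auto
qed

text \<open>The points are added one at a time. A point of the enlarged hull lies on a segment from
  some \<open>a\<close> in the old hull to the new point \<open>x\<close>. This segment crosses the
  chord joining the two latest old points at some \<open>b\<close>: up to \<open>b\<close> it stays
  in the old hull, after \<open>b\<close> in the new triangle.\<close>

lemma hull_cover:
  "Suc (Suc n) \<le> m \<Longrightarrow> convex hull (w ` {..Suc (Suc n)}) \<subseteq> (\<Union>k\<le>n. convex hull triangle k)"
proof (induction n)
  case 0
  have "w ` {..Suc (Suc 0)} = triangle 0"
    by (auto simp: triangle_def atMost_Suc)
  then show ?case by simp
next
  case (Suc n)
  define S where "S = w ` {..Suc (Suc n)}"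
  define k where "k = Suc n"
  define x where "x = w (Suc (Suc (Suc n)))"
  have k: "Suc k \<le> m" using Suc.prems by (simp add: k_def)
  have ins: "w ` {..Suc (Suc (Suc n))} = insert x S"
    by (simp add: S_def x_def atMost_Suc[of "Suc (Suc n)"])
  have IH: "convex hull S \<subseteq> (\<Union>k\<le>n. convex hull triangle k)"
    using Suc by (simp add: S_def)
  have S_le: "convex hull S \<subseteq> {y. normal k \<bullet> y \<le> normal k \<bullet> w k}"
    by (rule hull_minimal) (use normal_le[OF k] in \<open>auto simp: S_def k_def convex_halfspace_le\<close>)
  have x_ge: "normal k \<bullet> w k \<le> normal k \<bullet> x"
    unfolding x_def using normal_ge[of "Suc (Suc (Suc n))" k] Suc.prems by (simp add: k_def)
  have sub_V: "insert x S \<subseteq> V" using Suc.prems by (auto simp: V_def S_def x_def)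
  show ?case
  proof
    fix z assume "z \<in> convex hull (w ` {..Suc (Suc (Suc n))})"
    then have "z \<in> convex hull (insert x S)" using ins by simp
    moreover have "S \<noteq> {}" by (auto simp: S_def)
    ultimately obtain a where a: "a \<in> convex hull S" and z: "z \<in> closed_segment a x"
      by (auto simp: convex_hull_insert_segments closed_segment_commute)
    obtain b where b: "b \<in> closed_segment a x" "normal k \<bullet> b = normal k \<bullet> w k"
      using connected_ivt_hyperplane[of "closed_segment a x" a x "normal k" "normal k \<bullet> w k"] a S_le x_ge
      by auto
    \<comment> \<open>The intermediate value argument only puts \<open>b\<close> on the line. As
      \<open>b\<close> also lies in the disk, it belongs to the chord itself.\<close>
    have "closed_segment a x \<subseteq> convex hull V"
      using a sub_V hull_mono[of S V convex] hull_inc[of x V convex]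
      by (intro closed_segment_subset) auto
    then have "b \<in> closed_segment (w k) (w (Suc k))"
      using b norm_hull_V by (intro mem_chord k) auto
    then have bhull: "b \<in> convex hull S" "b \<in> convex hull triangle k"
      using closed_segment_subset_convex_hull[of "w k" S "w (Suc k)"]
        closed_segment_subset_convex_hull[of "w k" "triangle k" "w (Suc k)"]
      by (auto simp: S_def triangle_def k_def hull_inc)
    have xhull: "x \<in> convex hull triangle k"
      by (auto simp: triangle_def x_def k_def hull_inc)
    have "z \<in> closed_segment a b \<or> z \<in> closed_segment b x"
      using Un_closed_segment[OF b(1)] z by auto
    then show "z \<in> (\<Union>k\<le>Suc n. convex hull triangle k)"
    proof
      assume "z \<in> closed_segment a b"
      then have "z \<in> convex hull S"
        using a bhull(1) closed_segment_subset[OF _ _ convex_convex_hull] by blast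
      then show ?thesis using IH by fastforce
    next
      assume "z \<in> closed_segment b x"
      then have "z \<in> convex hull triangle k"
        using xhull bhull(2) closed_segment_subset[OF _ _ convex_convex_hull] by blast
      then show ?thesis by (auto simp: k_def)
    qed
  qed
qed

lemma hull_V: "(\<Union>t\<in>T. convex hull t) = convex hull V"
proof
  show "(\<Union>t\<in>T. convex hull t) \<subseteq> convex hull V"
    using Union_T by (intro UN_least hull_mono) auto
  have m: "Suc (Suc (m - 2)) = m" using m_ge_2 by simp
  then have "convex hull V \<subseteq> (\<Union>k\<le>m - 2. convex hull triangle k)"
    using hull_cover[of "m - 2"] by (simp add: V_def)
  also have "\<dots> \<subseteq> (\<Union>t\<in>T. convex hull t)"
  proof -
    have "Suc (Suc k) \<le> m" if "k \<le> m - 2" for k using that m_ge_2 by linarith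
    then show ?thesis by (auto simp: T_def)
  qed
  finally show "convex hull V \<subseteq> (\<Union>t\<in>T. convex hull t)" .
qed

section \<open>Triangles meet in common faces\<close>

text \<open>The line through \<open>w (i + 1)\<close> and \<open>w (i + 2)\<close> separates the triangles \<open>i\<close> and \<open>j\<close>.\<close>

lemma triangle_Int:
  assumes "i < j" "Suc (Suc j) \<le> m"
  shows "convex hull triangle i \<inter> convex hull triangle j \<subseteq> convex hull (triangle i \<inter> triangle j)"
proof
  fix z assume z: "z \<in> convex hull triangle i \<inter> convex hull triangle j"
  let ?a = "normal (Suc i)" and ?b = "normal (Suc i) \<bullet> w (Suc i)"
  have "convex hull triangle i \<subseteq> {y. ?a \<bullet> y \<le> ?b}"
    using assms normal_le[of "Suc i"] by (intro hull_minimal) (auto simp: triangle_def convex_halfspace_le)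
  then have "?a \<bullet> z \<le> ?b" using z by auto
  moreover have "?b \<le> ?a \<bullet> x" if "x \<in> triangle j" for x
    using that assms normal_ge[of _ "Suc i"] by (auto simp: triangle_def)
  ultimately have "z \<in> convex hull {x \<in> triangle j. ?a \<bullet> x = ?b}"
    using z by (intro convex_hull_supporting_hyperplane) (auto simp: triangle_def)
  moreover have "{x \<in> triangle j. ?a \<bullet> x = ?b} \<subseteq> triangle i \<inter> triangle j"
  proof
    fix x assume "x \<in> {x \<in> triangle j. ?a \<bullet> x = ?b}"
    then have x: "x \<in> triangle j" "?a \<bullet> x = ?b" by auto
    then obtain l where l: "x = w l" "j \<le> l" "l \<le> m" using assms by (auto simp: triangle_def)
    \<comment> \<open>Points of index above \<open>i + 2\<close> lie strictly beyond the line, and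
      \<open>l \<ge> j > i\<close>. So only the two ends of the chord remain, both vertices of
      triangle \<open>i\<close>; if \<open>j > i + 2\<close> the face is empty and the triangles are
      disjoint.\<close>
    then have "l = Suc i \<or> l = Suc (Suc i)"
      using normal_greater[of "Suc i" l] x assms by fastforce
    then show "x \<in> triangle i \<inter> triangle j" using x l by (auto simp: triangle_def)
  qed
  ultimately show "z \<in> convex hull (triangle i \<inter> triangle j)"
    using hull_mono by blast
qed

lemma hull_Int:
  assumes "t \<in> T" "t' \<in> T"
  shows "convex hull t \<inter> convex hull t' = convex hull (t \<inter> t')"
proof
  obtain i j where ij: "t = triangle i" "t' = triangle j" "Suc (Suc i) \<le> m" "Suc (Suc j) \<le> m"
    using assms by (auto simp: T_def)
  consider "i < j" | "j < i" | "i = j" by linarith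
  then show "convex hull t \<inter> convex hull t' \<subseteq> convex hull (t \<inter> t')"
  proof cases
    case 1
    then show ?thesis using triangle_Int[of i j] ij by simp
  next
    case 2
    then show ?thesis using triangle_Int[of j i] ij by (simp add: Int_commute)
  qed (simp add: ij)
  show "convex hull (t \<inter> t') \<subseteq> convex hull t \<inter> convex hull t'"
    by (simp add: hull_mono)
qed

text \<open>The vertices are distinct points of one circle, and a chord meets the circle only at its
  ends, so no segment between two of them contains the third.\<close>

lemma triangle_nondegenerate:
  assumes "Suc (Suc k) \<le> m"
  shows "card (triangle k) = 3" "\<not> hyp_collinear (triangle k)"
proof -
  show card: "card (triangle k) = 3"
    using assms by (simp add: triangle_def w_eq_iff)
  have circle: "norm z = \<rho>" if "z \<in> triangle k" for z
    using that assms norm_w by (auto simp: triangle_def)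
  have plane: "z \<in> hyp_plane" if "z \<in> triangle k" for z
    using that triangle_subset_V[OF assms] V_subset by auto
  show "\<not> hyp_collinear (triangle k)"
  proof
    assume "hyp_collinear (triangle k)"
    then obtain x y where xy: "x \<in> triangle k" "y \<in> triangle k" "triangle k \<subseteq> geodesic_seg x y"
      by (auto simp: hyp_collinear_def)
    have "triangle k \<subseteq> {x, y}"
    proof
      fix z assume z: "z \<in> triangle k"
      then have "z \<in> closed_segment x y"
        using xy plane geodesic_seg_eq_closed_segment by blast
      then show "z \<in> {x, y}"
        using circle_closed_segment_endpoint[of x \<rho> y z] circle xy z by auto
    qed
    then have "card (triangle k) \<le> card {x, y}" by (intro card_mono) auto
    also have "\<dots> \<le> 2" by (simp add: card_insert_if)
    finally show False using card by simp
  qed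
qed

lemma triangulation: "triangulation_of_hull V T"
  unfolding triangulation_of_hull_def
proof (intro conjI ballI)
  fix t assume "t \<in> T"
  then show "card t = 3" "\<not> hyp_collinear t"
    using triangle_nondegenerate by (auto simp: T_def)
next
  show "\<Union>T = V" by (rule Union_T)
  have "hyp_hull t = convex hull t" if "t \<in> T" for t
    using that Union_T by (intro hyp_hull_V) auto
  then show "(\<Union>t\<in>T. hyp_hull t) = hyp_hull V"
    using hull_V by (simp add: hyp_hull_V)
next
  fix t t' assume "t \<in> T" "t' \<in> T"
  then have "hyp_hull t = convex hull t" "hyp_hull t' = convex hull t'"
    "hyp_hull (t \<inter> t') = convex hull (t \<inter> t')"
    using Union_T by (auto intro!: hyp_hull_V)
  then show "hyp_hull t \<inter> hyp_hull t' = hyp_hull (t \<inter> t')"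
    using hull_Int[OF \<open>t \<in> T\<close> \<open>t' \<in> T\<close>] by simp
qed

text \<open>A Euclidean circle about the origin is also a hyperbolic one. All of \<open>V\<close>
  lies on it, so the same disk serves every triangle, and its interior contains no point of
  \<open>V\<close>.\<close>

lemma delaunay: "delaunay_triangulation V T"
  unfolding delaunay_triangulation_def
proof (intro conjI ballI triangulation)
  fix t assume t: "t \<in> T"
  define r where "r = arcosh (1 / sqrt (1 - \<rho>\<^sup>2))"
  have r: "hdist 0 v = r" if "v \<in> V" for v
    using that norm_w by (auto simp: hdist_def r_def V_def)
  then have "is_circumdisk 0 r t"
    using t Union_T by (auto simp: is_circumdisk_def hyp_plane_def)
  moreover have "open_hdisk 0 r \<inter> V = {}"
    using r by (auto simp: open_hdisk_def)
  ultimately show "\<exists>c r. is_circumdisk c r t \<and> open_hdisk c r \<inter> V = {}" by blast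
qed

end

section \<open>Graph distance and stretch factor\<close>

lemma skeleton_sel [simp]:
  "verts (skeleton V T) = V"
  "arcs (skeleton V T) = {(p, q). p \<noteq> q \<and> (\<exists>t\<in>T. p \<in> t \<and> q \<in> t)}"
  "tail (skeleton V T) = fst"
  "head (skeleton V T) = snd"
  by (simp_all add: skeleton_def)

lemma wf_digraph_skeleton: "\<Union>T \<subseteq> V \<Longrightarrow> wf_digraph (skeleton V T)"
  by unfold_locales auto

text \<open>Duality bound for shortest paths: the increments of a potential \<open>f\<close>
  telescope along a walk, and each is at most the length of its edge. The walk \<open>p\<close>
  guarantees that the distance is finite.\<close>

lemma graph_dist_ge_potential:
  assumes T: "\<Union>T \<subseteq> V"
    and p: "pre_digraph.awalk (skeleton V T) u p v"
    and f: "\<And>t x y. t \<in> T \<Longrightarrow> x \<in> t \<Longrightarrow> y \<in> t \<Longrightarrow> x \<noteq> y \<Longrightarrow> f y - f x \<le> hdist x y"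
  shows "f v - f u \<le> graph_dist V T u v"
proof -
  interpret G: wf_digraph "skeleton V T" using T by (rule wf_digraph_skeleton)
  let ?c = "\<lambda>(x, y). hdist x y"
  have walk: "f v - f u \<le> G.awalk_cost ?c p" if "G.awalk u p v" for u p
    using that
  proof (induction p arbitrary: u)
    case Nil
    then show ?case by (simp add: G.awalk_Nil_iff)
  next
    case (Cons e p)
    obtain y where e: "e = (u, y)"
      using Cons.prems by (cases e) (auto simp: G.awalk_Cons_iff)
    then have "f v - f y \<le> G.awalk_cost ?c p" "f y - f u \<le> hdist u y"
      using Cons f by (auto simp: G.awalk_Cons_iff)
    then show ?case by (simp add: e)
  qed
  have "ereal (f v - f u) \<le> G.\<mu> ?c u v"
    unfolding G.\<mu>_def using walk by (intro INF_greatest) auto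
  \<comment> \<open>This rules out the value infinity, which \<open>real_of_ereal\<close> would send
    to 0.\<close>
  moreover have "G.\<mu> ?c u v \<le> ereal (G.awalk_cost ?c p)"
    by (rule G.min_cost_le_walk_cost[OF p])
  ultimately show ?thesis
    unfolding graph_dist_def by (cases "G.\<mu> ?c u v") auto
qed

lemma stretch_factor_ge:
  assumes "finite V" "p \<in> V" "q \<in> V" "p \<noteq> q"
  shows "graph_dist V T p q / hdist p q \<le> stretch_factor V T"
proof -
  let ?S = "{graph_dist V T p q / hdist p q | p q. p \<in> V \<and> q \<in> V \<and> p \<noteq> q}"
  have "?S \<subseteq> (\<lambda>(p, q). graph_dist V T p q / hdist p q) ` (V \<times> V)" by auto
  then have "finite ?S" by (rule finite_subset) (use assms(1) in auto)
  then show ?thesis unfolding stretch_factor_def using assms by (intro Max_ge) auto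
qed

text \<open>On a common circle the two square roots multiply to \<open>1 - \<rho>\<^sup>2\<close>,
  and polarization expresses \<open>x \<bullet> y\<close> through the chord length.\<close>

lemma hdist_circle:
  assumes "norm x = \<rho>" "norm y = \<rho>" "\<rho> < 1"
  shows "hdist x y = arcosh (1 + (norm (x - y))\<^sup>2 / (2 * (1 - \<rho>\<^sup>2)))"
proof -
  have "\<rho> \<ge> 0" using assms(1) by auto
  then have pos: "1 - \<rho>\<^sup>2 > 0" using assms(3) by (simp add: abs_square_less_1)
  have "x \<bullet> x = \<rho>\<^sup>2" "y \<bullet> y = \<rho>\<^sup>2"
    using assms by (auto simp flip: power2_norm_eq_inner)
  then have "(norm (x - y))\<^sup>2 = 2 * \<rho>\<^sup>2 - 2 * (x \<bullet> y)"
    unfolding power2_norm_eq_inner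
    by (simp add: inner_diff_left inner_diff_right inner_commute[of y x])
  then have "2 * (1 - \<rho>\<^sup>2) + (norm (x - y))\<^sup>2 = 2 * (1 - x \<bullet> y)" by simp
  moreover have "1 + (norm (x - y))\<^sup>2 / (2 * (1 - \<rho>\<^sup>2)) = (2 * (1 - \<rho>\<^sup>2) + (norm (x - y))\<^sup>2) / (2 * (1 - \<rho>\<^sup>2))"
    using pos by (simp add: add_divide_distrib)
  ultimately have "1 + (norm (x - y))\<^sup>2 / (2 * (1 - \<rho>\<^sup>2)) = (1 - x \<bullet> y) / (1 - \<rho>\<^sup>2)"
    by (simp only: mult_divide_mult_cancel_left)
  then show ?thesis using assms pos by (simp add: hdist_def)
qed

context zigzag
begin

text \<open>Following consecutive indices supplies the walk that makes the potential bound
  applicable.\<close>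

lemma awalk_V:
  "k \<le> m \<Longrightarrow> \<exists>p. pre_digraph.awalk (skeleton V T) (w 0) p (w k)"
proof (induction k)
  case 0
  interpret G: wf_digraph "skeleton V T" using Union_T by (intro wf_digraph_skeleton) auto
  have "w 0 \<in> V" by (simp add: V_def)
  then show ?case by (intro exI[of _ "[]"]) (simp add: G.awalk_Nil_iff)
next
  case (Suc k)
  interpret G: wf_digraph "skeleton V T" using Union_T by (intro wf_digraph_skeleton) auto
  obtain p where p: "G.awalk (w 0) p (w k)" using Suc by auto
  have edge: "\<exists>t\<in>T. w k \<in> t \<and> w (Suc k) \<in> t"
  proof (cases "Suc (Suc k) \<le> m")
    case True
    then show ?thesis by (auto simp: T_def triangle_def)
  next
    case False
    \<comment> \<open>Here \<open>k = m - 1\<close>, and the last edge belongs to the triangle of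
      index \<open>k - 1\<close>.\<close>
    then have "k = Suc (k - 1)" "Suc (Suc (k - 1)) \<le> m" using Suc.prems m_ge_2 by auto
    then show ?thesis unfolding T_def triangle_def by (metis (mono_tags, lifting) image_eqI insertCI mem_Collect_eq)
  qed
  have "w k \<noteq> w (Suc k)" using Suc.prems by (simp add: w_eq_iff)
  moreover have "w (Suc k) \<in> V" "w k \<in> V" using Suc.prems by (auto simp: V_def)
  ultimately have "G.awalk (w k) [(w k, w (Suc k))] (w (Suc k))"
    using edge by (auto simp: G.awalk_Cons_iff G.awalk_Nil_iff)
  with p show ?case by (blast intro: G.awalk_appendI)
qed

end

section \<open>Point sets with large stretch factor\<close>

lemma arcosh_le_ln:
  fixes x :: real
  assumes "1 \<le> x"
  shows "arcosh x \<le> ln (2 * x)"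
proof -
  have "sqrt (x\<^sup>2 - 1) \<le> x" using assms by (intro real_le_lsqrt) auto
  moreover have "0 \<le> sqrt (x\<^sup>2 - 1)" using assms by simp
  ultimately have "ln (x + sqrt (x\<^sup>2 - 1)) \<le> ln (2 * x)"
    using assms by (subst ln_le_cancel_iff) linarith+
  then show ?thesis using assms by (simp add: arcosh_real_def)
qed

text \<open>
  The radius is chosen so that the smallest Euclidean distance \<open>1 / (2 * m)\<close> between two of the
  points corresponds to a hyperbolic distance of at least \<open>arcosh 2\<close>.
\<close>

lemma exists_stretch_ge:
  assumes m: "2 \<le> m"
  shows "\<exists>V T. finite V \<and> V \<subseteq> hyp_plane \<and> 2 \<le> card V \<and> delaunay_triangulation V T \<and>
    real m / 2 * arcosh 2 / ln (2 + 32 * (real m)\<^sup>2) \<le> stretch_factor V T"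
proof -
  \<comment> \<open>With \<open>1 - \<rho>\<^sup>2 = \<epsilon>\<close> the factor in
    \<open>hdist_circle\<close> becomes \<open>4 * (real m)\<^sup>2\<close>, so a chord of length
    \<open>1 / (2 * m)\<close> gives exactly \<open>arcosh 2\<close>.\<close>
  define \<epsilon> where "\<epsilon> = 1 / (8 * (real m)\<^sup>2)"
  define \<rho> where "\<rho> = sqrt (1 - \<epsilon>)"
  \<comment> \<open>The real parts run from 0 to 1/2 only, which keeps the radicand in
    \<open>w\<close> positive, so every point is off the real axis.\<close>
  define a where "a k = real k / (2 * real m)" for k
  define w where "w k = Complex (a k) ((-1) ^ k * sqrt (1 - \<epsilon> - (a k)\<^sup>2))" for k
  have "(real m)\<^sup>2 \<ge> 2\<^sup>2" using m by (intro power_mono) auto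
  then have \<epsilon>: "0 < \<epsilon>" "\<epsilon> \<le> 1 / 32" using m by (auto simp: \<epsilon>_def field_simps)
  have \<rho>: "\<rho> < 1" "\<rho>\<^sup>2 = 1 - \<epsilon>" using \<epsilon> by (auto simp: \<rho>_def)
  have h: "1 - \<epsilon> - (a k)\<^sup>2 > 0" if "k \<le> m" for k
  proof -
    have "0 \<le> a k" "a k \<le> 1 / 2" using that m by (auto simp: a_def field_simps)
    then have "(a k)\<^sup>2 \<le> (1 / 2)\<^sup>2" by (intro power_mono)
    then show ?thesis using \<epsilon> by (simp add: power2_eq_square)
  qed
  interpret zigzag w \<rho> m
  proof
    show "norm (w k) = \<rho>" if "k \<le> m" for k
      using h[OF that] by (simp add: w_def cmod_def power_mult_distrib \<rho>_def flip: power_mult)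
    show "Re (w i) < Re (w j)" if "i < j" "j \<le> m" for i j
      using that m by (simp add: w_def a_def divide_strict_right_mono)
    show "(-1) ^ k * Im (w k) > 0" if "k \<le> m" for k
      using h[OF that] by (simp add: w_def flip: power_add mult_2)
  qed (use m \<rho> in auto)
  have Re_w: "Re (w k) = a k" for k by (simp add: w_def)
  have hd: "hdist (w i) (w j) = arcosh (1 + 4 * (real m)\<^sup>2 * (norm (w i - w j))\<^sup>2)"
    if "i \<le> m" "j \<le> m" for i j
    using hdist_circle[of "w i" \<rho> "w j"] that norm_w \<rho> by (simp add: \<epsilon>_def mult_ac)
  have far: "arcosh 2 \<le> hdist (w i) (w j)" if "i \<le> m" "j \<le> m" "i \<noteq> j" for i j
  proof -
    have "1 \<le> \<bar>real i - real j\<bar>" using that(3) by linarith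
    then have "1 / (2 * real m) \<le> \<bar>a i - a j\<bar>"
      by (simp add: a_def divide_right_mono flip: diff_divide_distrib)
    also have "\<dots> \<le> norm (w i - w j)"
      using abs_Re_le_cmod[of "w i - w j"] by (simp add: Re_w)
    finally have "(1 / (2 * real m))\<^sup>2 \<le> (norm (w i - w j))\<^sup>2"
      by (intro power_mono) auto
    then have "2 \<le> 1 + 4 * (real m)\<^sup>2 * (norm (w i - w j))\<^sup>2"
      using m by (simp add: field_simps)
    then have "\<not> 1 + 4 * (real m)\<^sup>2 * (norm (w i - w j))\<^sup>2 < 2" by simp
    then show ?thesis unfolding hd[OF that(1,2)]
      by (subst not_less[symmetric], subst arcosh_less_iff_real) auto
  qed
  \<comment> \<open>The potential is a scaled real part: an edge advances at most two indices, hence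
    at most \<open>1 / m\<close> in real part and \<open>arcosh 2\<close> in \<open>f\<close>, while
    \<open>f\<close> grows by \<open>m / 2 * arcosh 2\<close> from \<open>w 0\<close> to
    \<open>w m\<close>.\<close>
  define f where "f z = real m * arcosh 2 * Re z" for z
  have arcosh2: "arcosh (2::real) > 0" by simp
  have "f y - f x \<le> hdist x y" if t: "t \<in> T" "x \<in> t" "y \<in> t" "x \<noteq> y" for t x y
  proof -
    obtain i j where ij: "x = w i" "y = w j" "i \<le> m" "j \<le> m" "j \<le> i + 2"
      using t by (auto simp: T_def triangle_def)
    have "real m * (a j - a i) = (real j - real i) / 2"
      using m by (simp add: a_def field_simps)
    also have "\<dots> \<le> 1" using ij(5) by simp
    finally have "real m * (a j - a i) \<le> 1" .
    then have "arcosh 2 * (real m * (a j - a i)) \<le> arcosh 2 * 1"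
      using arcosh2 by (intro mult_left_mono) auto
    then have "f y - f x \<le> arcosh 2"
      by (simp add: f_def ij Re_w algebra_simps)
    also have "\<dots> \<le> hdist x y" using far[of i j] ij t by auto
    finally show ?thesis .
  qed
  moreover obtain p where "pre_digraph.awalk (skeleton V T) (w 0) p (w m)"
    using awalk_V by blast
  ultimately have "f (w m) - f (w 0) \<le> graph_dist V T (w 0) (w m)"
    using Union_T by (intro graph_dist_ge_potential) auto
  moreover have "f (w m) - f (w 0) = real m / 2 * arcosh 2"
    using m by (simp add: f_def Re_w a_def)
  ultimately have gd: "real m / 2 * arcosh 2 \<le> graph_dist V T (w 0) (w m)" by simp
  have hpos: "0 < hdist (w 0) (w m)" using far[of 0 m] arcosh2 m by linarith
  \<comment> \<open>The diameter of the disk suffices as a bound: the \<open>arcosh\<close> argument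
    is at most \<open>1 + 16 * m^2\<close>, and \<open>arcosh_le_ln\<close> doubles it inside the
    logarithm.\<close>
  have "norm (w 0 - w m) \<le> 2"
    using norm_triangle_ineq4[of "w 0" "w m"] norm_w[of 0] norm_w[of m] \<rho> by simp
  then have "(norm (w 0 - w m))\<^sup>2 \<le> 2\<^sup>2" by (intro power_mono) auto
  then have "4 * (real m)\<^sup>2 * (norm (w 0 - w m))\<^sup>2 \<le> 4 * (real m)\<^sup>2 * 2\<^sup>2"
    by (intro mult_left_mono) auto
  then have "ln (2 * (1 + 4 * (real m)\<^sup>2 * (norm (w 0 - w m))\<^sup>2)) \<le> ln (2 + 32 * (real m)\<^sup>2)"
    by (intro ln_mono) (auto intro: add_pos_nonneg)
  then have hle: "hdist (w 0) (w m) \<le> ln (2 + 32 * (real m)\<^sup>2)"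
    using arcosh_le_ln[of "1 + 4 * (real m)\<^sup>2 * (norm (w 0 - w m))\<^sup>2"] by (simp add: hd)
  have "real m / 2 * arcosh 2 / ln (2 + 32 * (real m)\<^sup>2) \<le> graph_dist V T (w 0) (w m) / hdist (w 0) (w m)"
    using gd hle hpos by (intro frac_le order_trans[OF _ gd]) auto
  also have "\<dots> \<le> stretch_factor V T"
    using m w_eq_iff[of 0 m] by (intro stretch_factor_ge) (auto simp: V_def)
  finally have "real m / 2 * arcosh 2 / ln (2 + 32 * (real m)\<^sup>2) \<le> stretch_factor V T" .
  moreover have "card V = Suc m"
    unfolding V_def by (subst card_image) (auto simp: inj_on_def w_eq_iff)
  moreover have "finite V" by (simp add: V_def)
  ultimately show ?thesis using delaunay V_subset m by (intro exI[of _ V] exI[of _ T]) auto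
qed

theorem theorem1p2:
  shows "\<forall>C::real. C > 0 \<longrightarrow> (\<exists>V T.
           finite V \<and> V \<subseteq> hyp_plane \<and> 2 \<le> card V \<and>
           delaunay_triangulation V T \<and> stretch_factor V T > C)"
proof (intro allI impI)
  fix C :: real
  \<comment> \<open>Linear growth beats logarithmic growth. The positive constant \<open>c\<close>
    stands for \<open>arcosh 2\<close>, of which only the sign matters.\<close>
  have "filterlim (\<lambda>m. real m / 2 * c / ln (2 + 32 * (real m)\<^sup>2)) at_top sequentially"
    if "c > 0" for c :: real
    using that by real_asymp
  from this[of "arcosh 2"] have "eventually (\<lambda>m. C < real m / 2 * arcosh 2 / ln (2 + 32 * (real m)\<^sup>2)) sequentially"
    by (simp add: filterlim_at_top_dense)
  then obtain m where "2 \<le> m" "C < real m / 2 * arcosh 2 / ln (2 + 32 * (real m)\<^sup>2)"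
    using eventually_happens[OF eventually_conj[OF eventually_ge_at_top[of 2]]] by auto
  then show "\<exists>V T. finite V \<and> V \<subseteq> hyp_plane \<and> 2 \<le> card V \<and>
      delaunay_triangulation V T \<and> stretch_factor V T > C"
    using exists_stretch_ge[of m] by (meson less_le_trans)
qed

end
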